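(* For every integer $d\ge 2$ there is a constant $C_d>0$ such that the following holds. Let $\mathcal{T}$ be a non-adaptive test that makes $q\geq 1$ queries and that is a degree-$(d-1)$ relaxed linearity test with completeness $c$ and soundness $s$ for functions $f:\{0,1\}^n\to\{-1,1\}$. Then $$1-c+s\ \ge\ 2^{-q+C_d\,q^{1/d}}.$$ Equivalently, when $c=1$: the amortized query complexity of $\mathcal{T}$ is at least $1+\Omega_d\!\left(\frac{1}{q^{(d-1)/d}}\right)$.
   Context: A function $f:\{0,1\}^n\to\{-1,1\}$ is linear if $f(x)=(-1)^{\sum_{i\in S}x_i}$ for some $S\subseteq\{1,\dots,n\}$. Addition in $\{0,1\}^n$ is bitwise XOR, and $[d]=\{1,\dots,d\}$. The dimension-$d$ Gowers uniformity of $f:\{0,1\}^n\to\mathbb{R}$ is $$U^d(f):=\mathbb{E}_{x,x_1,\dots,x_d}\prod_{S\subseteq[d]}f\Big(x+\sum_{i\in S}x_i\Big),$$ with $x,x_1,\dots,x_d$ independent and uniform in $\{0,1\}^n$. A test is a randomized procedure with oracle access to $f:\{0,1\}^n\to\{-1,1\}$ (defined for every $n$, $q$ being independent of $n$) that either accepts or rejects; it is non-adaptive if it makes all its $q$ queries simultaneously, i.e. the queries do not depend on answers to other queries. It is a degree-$(d-1)$ relaxed linearity test with completeness $c$ and soundness $s$ if: (1) whenever $f$ is linear it accepts with probability at least $c$; (2) whenever $U^d(f)\le\epsilon$ it accepts with probability at most $s+\epsilon'$, where $\epsilon'=\epsilon'(\epsilon)$ depends only on $\epsilon$ (not on $n$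 or $f$) and $\epsilon'\to 0$ as $\epsilon\to 0$. The amortized query complexity of a test with $q$ queries and soundness $s$ is $q/\log_2(s^{-1})$ (taken to be $+\infty$ if $s\geq 1$). *)

theory Defs
  imports
    "HOL-Probability.Probability"
    "HOL-Library.Z2"
    "HOL-Library.Function_Algebras"
begin

text \<open>
  The cube \<open>{0,1}\<^sup>n\<close> consists of the functions \<^typ>\<open>nat \<Rightarrow> bit\<close> that vanish outside the
  coordinates \<open>{1..n}\<close>, so that a single type serves all \<open>n\<close>. Since \<^typ>\<open>bit\<close> is the
  two-element field, the pointwise addition of functions is bitwise XOR.
\<close>

type_synonym point = "nat \<Rightarrow> bit"

definition cube :: "nat \<Rightarrow> point set" where
  "cube n = {x. \<forall>i. i \<notin> {1..n} \<longrightarrow> x i = 0}"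

text \<open>
  Functions on the cube are total functions on \<^typ>\<open>point\<close>; only their values on
  \<^term>\<open>cube n\<close> matter.
\<close>

definition boolean_function :: "nat \<Rightarrow> (point \<Rightarrow> real) \<Rightarrow> bool" where
  "boolean_function n f \<longleftrightarrow> f \<in> cube n \<rightarrow> {-1, 1}"

definition linear_function :: "nat \<Rightarrow> (point \<Rightarrow> real) \<Rightarrow> bool" where
  "linear_function n f \<longleftrightarrow>
     (\<exists>S \<subseteq> {1..n}. \<forall>x \<in> cube n. f x = (-1) ^ (\<Sum>i\<in>S. of_bit (x i)))"

definition gowers_uniformity :: "nat \<Rightarrow> nat \<Rightarrow> (point \<Rightarrow> real) \<Rightarrow> real" where
  "gowers_uniformity d n f =
     measure_pmf.expectation
       (pair_pmf (pmf_of_set (cube n)) (Pi_pmf {1..d} 0 (\<lambda>_. pmf_of_set (cube n))))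
       (\<lambda>(x, y). \<Prod>S\<in>Pow {1..d}. f (x + (\<Sum>i\<in>S. y i)))"

text \<open>
  For each \<open>n\<close>, a non-adaptive test draws, before seeing any answer, a list of queries together
  with the predicate that decides acceptance from the list of answers. A discrete distribution
  loses no generality: for fixed \<open>n\<close> and \<open>q\<close> there are only finitely many query lists and, up to
  their values on \<open>{-1,1}\<^sup>q\<close>, finitely many predicates; a randomized decision is a
  distribution over predicates.
\<close>

type_synonym test = "nat \<Rightarrow> (point list \<times> (real list \<Rightarrow> bool)) pmf"

definition nonadaptive_test :: "nat \<Rightarrow> test \<Rightarrow> bool" where
  "nonadaptive_test q T \<longleftrightarrow>
     (\<forall>n\<ge>1. \<forall>(Q, D) \<in> set_pmf (T n). length Q = q \<and> set Q \<subseteq> cube n)"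

definition accept_prob :: "test \<Rightarrow> nat \<Rightarrow> (point \<Rightarrow> real) \<Rightarrow> real" where
  "accept_prob T n f = measure_pmf.prob (T n) {(Q, D). D (map f Q)}"

text \<open>
  The parameter \<open>d\<close> is the dimension of the Gowers uniformity; the degree of the test is
  \<open>d - 1\<close>. The error function \<open>\<epsilon>'\<close> is chosen before \<open>n\<close> and \<open>f\<close>.
\<close>

definition relaxed_linearity_test :: "nat \<Rightarrow> real \<Rightarrow> real \<Rightarrow> test \<Rightarrow> bool" where
  "relaxed_linearity_test d c s T \<longleftrightarrow>
     (\<forall>n\<ge>1. \<forall>f. boolean_function n f \<longrightarrow> linear_function n f \<longrightarrow> c \<le> accept_prob T n f) \<and>
     (\<exists>\<epsilon>' :: real \<Rightarrow> real. (\<epsilon>' \<longlongrightarrow> 0) (at_right 0) \<and>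
       (\<forall>\<epsilon>>0. \<forall>n\<ge>1. \<forall>f. boolean_function n f \<longrightarrow> gowers_uniformity d n f \<le> \<epsilon> \<longrightarrow>
          accept_prob T n f \<le> s + \<epsilon>' \<epsilon>))"

text \<open>
  At \<open>s = 0\<close> the logarithm of \<open>1/s\<close> is infinite, so the quotient is \<open>0\<close>.
\<close>

definition amortized_query_complexity :: "nat \<Rightarrow> real \<Rightarrow> ereal" where
  "amortized_query_complexity q s =
     (if s \<ge> 1 then \<infinity> else if s \<le> 0 then 0 else ereal (real q / log 2 (1 / s)))"

lemma finite_cube [simp]: "finite (cube n)"
proof -
  have "cube n = PiE_dflt {1..n} 0 (\<lambda>_. UNIV)"
    by (auto simp: cube_def PiE_dflt_def)
  moreover have "finite (UNIV :: bit set)"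
  proof (rule finite_subset)
    show "(UNIV :: bit set) \<subseteq> {0, 1}" by (auto simp: bit_not_zero_iff)
  qed simp
  ultimately show ?thesis by (simp add: finite_PiE_dflt)
qed

lemma zero_in_cube [simp]: "0 \<in> cube n"
  by (simp add: cube_def)

lemma cube_nonempty [simp]: "cube n \<noteq> {}"
  using zero_in_cube by blast

lemma add_in_cube [intro]: "x \<in> cube n \<Longrightarrow> y \<in> cube n \<Longrightarrow> x + y \<in> cube n"
  by (simp add: cube_def)

lemma sum_in_cube [intro]: "(\<And>i. i \<in> S \<Longrightarrow> y i \<in> cube n) \<Longrightarrow> (\<Sum>i\<in>S. y i) \<in> cube n"
  by (induction S rule: infinite_finite_induct) auto

end

theory Submission
  imports Defs "HOL-Real_Asymp.Real_Asymp"
begin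

text \<open>
  Compare two random functions: the sign of a uniform linear form, and the sign of a uniform
  polynomial of degree at most \<open>d\<close> without constant term over the two-element field. The latter
  has expected \<open>d\<close>-dimensional uniformity at most \<open>2\<^sup>d / 2\<^sup>n\<close>: its derivative in \<open>d\<close> independent
  directions is a uniform bit, and random directions are independent with high probability. As the
  uniformity is nonnegative, Markov's inequality shows that the test accepts such a polynomial
  with probability at most \<open>s + o(1)\<close> as \<open>n\<close> grows.

  On a fixed list of \<open>q\<close> queries spanning a space of dimension \<open>r\<close>, the answers of a random linear
  form are uniform in a space of size \<open>2\<^sup>r\<close>, and those of a random polynomial are uniform in a
  larger space, of size at most \<open>2\<close> to the power \<open>min q (r\<^sup>d)\<close>. Hence each decision predicate
  accepts the polynomial with at least \<open>2\<close> to the power \<open>r - min q (r\<^sup>d)\<close> times the probability with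
  which it accepts the linear form. The worst case over \<open>r\<close> is \<open>r \<approx> q\<^bsup>1/d\<^esup>\<close>, which gives
  \<open>s \<ge> \<delta> * c\<close> with \<open>\<delta>\<close> equal to \<open>2\<close> to the power \<open>- q + q\<^bsup>1/d\<^esup> / 2\<close>.
\<close>

section \<open>Linear algebra over the two-element field\<close>

text \<open>By default the simplifier rewrites ring operations on bits to bit operations, out of reach
  of the algebraic rules.\<close>

declare add_bit_eq_xor [simp del] mult_bit_eq_and [simp del] power_bit_unfold [simp del]

definition bit_sign :: "bit \<Rightarrow> real" where
  "bit_sign b = (-1) ^ of_bit b"

lemma sign_simps [simp]: "bit_sign 0 = 1" "bit_sign 1 = -1"
  by (simp_all add: bit_sign_def)

lemma sign_add: "bit_sign (a + b) = bit_sign a * bit_sign b"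
  by (cases a; cases b) auto

lemma sign_values: "bit_sign b \<in> {-1, 1}"
  by (cases b) auto

lemma sign_sum: "bit_sign (\<Sum>i\<in>A. g i) = (\<Prod>i\<in>A. bit_sign (g i))"
  by (induction A rule: infinite_finite_induct) (auto simp: sign_add)

lemma abs_sign [simp]: "\<bar>bit_sign b\<bar> = 1"
  by (cases b) auto

lemma bit_double [simp]: "a + a = (0::bit)"
  by (cases a) auto

lemma bit_add_eq_0_iff: "a + b = 0 \<longleftrightarrow> a = (b::bit)"
  by (cases a; cases b) auto

lemma bit_double_left [simp]: "a + (a + b) = (b::bit)"
  by (simp flip: add.assoc)

lemma point_double [simp]: "x + x = (0::'a \<Rightarrow> bit)"
  by (simp add: fun_eq_iff)

lemma point_double_left [simp]: "x + (x + y) = (y::'a \<Rightarrow> bit)"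
  by (simp add: fun_eq_iff)

lemma sum_fun_apply: "(\<Sum>i\<in>A. g i) x = (\<Sum>i\<in>A. g i x)"
  for g :: "'a \<Rightarrow> 'b \<Rightarrow> 'c::comm_monoid_add"
  by (induction A rule: infinite_finite_induct) auto

lemma finite_UNIV_bit: "finite (UNIV :: bit set)" and card_UNIV_bit: "card (UNIV :: bit set) = 2"
proof -
  have "UNIV = {0, 1 :: bit}"
    by (auto simp: bit_not_zero_iff)
  then show "finite (UNIV :: bit set)" "card (UNIV :: bit set) = 2"
    by (simp_all add: \<open>UNIV = {0, 1 :: bit}\<close>)
qed

lemma card_cube: "card (cube n) = 2 ^ n"
proof -
  have "cube n = PiE_dflt {1..n} 0 (\<lambda>_. UNIV)"
    by (auto simp: cube_def PiE_dflt_def)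
  then show ?thesis
    by (simp add: card_PiE_dflt finite_UNIV_bit card_UNIV_bit)
qed

text \<open>Gives access to spans, bases and the extension of functionals, so that a list of queries
  has a rank.\<close>

interpretation point: vector_space "\<lambda>(c::bit) (v::point). (\<lambda>i. c * v i)"
  by unfold_locales
    (simp_all only: fun_eq_iff distrib_left distrib_right mult.assoc plus_fun_apply mult_1_left HOL.simp_thms)

interpretation functional: vector_space_pair "\<lambda>(c::bit) (v::point). (\<lambda>i. c * v i)" "(*) :: bit \<Rightarrow> bit \<Rightarrow> bit"
  by unfold_locales

lemma point_eq_sum_units:
  assumes "x \<in> cube n"
  shows "x = (\<Sum>i\<in>{1..n}. (\<lambda>j. x i * of_bool (j = i)))"
proof
  fix j
  have "(\<Sum>i\<in>{1..n}. x i * of_bool (j = i)) = (if j \<in> {1..n} then x j else 0)"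
    using sum.delta[of "{1..n}" j x] by (simp add: of_bool_def if_distrib cong: if_cong)
  also have "\<dots> = x j"
    using assms by (auto simp: cube_def)
  finally show "x j = (\<Sum>i\<in>{1..n}. (\<lambda>j. x i * of_bool (j = i))) j"
    by (simp add: sum_fun_apply)
qed

text \<open>The prescribed values extend from the independent set to a linear functional on all
  points; the coefficients \<open>a\<close> are its values at the unit vectors. Only points of the
  cube are sums of the units indexed by \<open>{1..n}\<close>, hence the intersection.\<close>

lemma functional_extension:
  assumes "point.independent B"
  obtains a :: "nat \<Rightarrow> bit"
  where "\<And>x. x \<in> B \<inter> cube n \<Longrightarrow> (\<Sum>i\<in>{1..n}. a i * x i) = g x"
proof -
  obtain \<phi> where \<phi>: "Vector_Spaces.linear (\<lambda>(c::bit) (v::point). (\<lambda>i. c * v i)) (*) \<phi>" "\<forall>x\<in>B. \<phi> x = g x"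
    using functional.linear_independent_extend[OF assms] by blast
  interpret \<phi>: Vector_Spaces.linear "\<lambda>(c::bit) (v::point). (\<lambda>i. c * v i)" "(*)" \<phi>
    by (rule \<phi>(1))
  show ?thesis
  proof (rule that)
    fix x assume x: "x \<in> B \<inter> cube n"
    have "g x = \<phi> (\<Sum>i\<in>{1..n}. (\<lambda>j. x i * of_bool (j = i)))"
      by (subst point_eq_sum_units[of x n, symmetric]) (use x \<phi>(2) in auto)
    also have "\<dots> = (\<Sum>i\<in>{1..n}. \<phi> (\<lambda>j. x i * of_bool (j = i)))"
      by (simp add: \<phi>.sum)
    also have "\<dots> = (\<Sum>i\<in>{1..n}. x i * \<phi> (\<lambda>j. of_bool (j = i)))"
      by (intro sum.cong refl \<phi>.scale)
    finally show "(\<Sum>i\<in>{1..n}. \<phi> (\<lambda>j. of_bool (j = i)) * x i) = g x"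
      by (simp add: mult.commute)
  qed
qed

section \<open>Linear forms and polynomials\<close>

definition linear_forms :: "nat \<Rightarrow> (point \<Rightarrow> bit) set" where
  "linear_forms n = (\<lambda>S x. \<Sum>i\<in>S. x i) ` Pow {1..n}"

text \<open>Indices in a tuple \<open>I\<close> may repeat and bits are idempotent, so for
  \<open>d \<ge> 1\<close> monomials of every degree from 1 to \<open>d\<close> occur. Taking the
  image counts each function once, although several \<open>X\<close> may define it.\<close>

definition polynomials :: "nat \<Rightarrow> nat \<Rightarrow> (point \<Rightarrow> bit) set" where
  "polynomials d n = (\<lambda>X x. \<Sum>I\<in>X. \<Prod>l\<in>{1..d}. x (I l)) ` Pow ({1..d} \<rightarrow>\<^sub>E {1..n})"

text \<open>In characteristic 2 this describes a finite subgroup: \<open>p + p\<close> is zero, so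
  each element is its own inverse.\<close>

definition additive_family :: "('a \<Rightarrow> bit) set \<Rightarrow> bool" where
  "additive_family P \<longleftrightarrow> finite P \<and> P \<noteq> {} \<and> (\<forall>p\<in>P. \<forall>p'\<in>P. p + p' \<in> P)"

text \<open>The terms over \<open>X \<inter> Y\<close> occur twice on the right and cancel.\<close>

lemma sum_sym_diff:
  fixes g :: "'a \<Rightarrow> bit"
  assumes "finite X" "finite Y"
  shows "(\<Sum>i\<in>(X - Y) \<union> (Y - X). g i) = (\<Sum>i\<in>X. g i) + (\<Sum>i\<in>Y. g i)"
proof -
  have "(\<Sum>i\<in>X. g i) = (\<Sum>i\<in>X - Y. g i) + (\<Sum>i\<in>X \<inter> Y. g i)"
    using sum.Int_Diff[OF assms(1), of g Y] by (simp only: add.commute)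
  moreover have "(\<Sum>i\<in>Y. g i) = (\<Sum>i\<in>X \<inter> Y. g i) + (\<Sum>i\<in>Y - X. g i)"
    using sum.Int_Diff[OF assms(2), of g X] by (simp only: Int_commute)
  moreover have "(\<Sum>i\<in>(X - Y) \<union> (Y - X). g i) = (\<Sum>i\<in>X - Y. g i) + (\<Sum>i\<in>Y - X. g i)"
    using assms by (intro sum.union_disjoint) auto
  ultimately show ?thesis
    by (simp only: add.assoc bit_double_left)
qed

lemma additive_family_subset_sums:
  assumes "finite A"
  shows "additive_family ((\<lambda>X x. \<Sum>i\<in>X. m i x) ` Pow A)"
  unfolding additive_family_def
proof (intro conjI ballI)
  show "finite ((\<lambda>X x. \<Sum>i\<in>X. m i x) ` Pow A)"
    using assms by simp
  fix p p' assume "p \<in> (\<lambda>X x. \<Sum>i\<in>X. m i x) ` Pow A" "p' \<in> (\<lambda>X x. \<Sum>i\<in>X. m i x) ` Pow A"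
  then obtain X Y where "X \<subseteq> A" "Y \<subseteq> A" "p = (\<lambda>x. \<Sum>i\<in>X. m i x)" "p' = (\<lambda>x. \<Sum>i\<in>Y. m i x)"
    by auto
  then have "p + p' = (\<lambda>x. \<Sum>i\<in>(X - Y) \<union> (Y - X). m i x)"
    using assms by (subst sum_sym_diff) (auto simp: fun_eq_iff dest: finite_subset)
  moreover have "(X - Y) \<union> (Y - X) \<subseteq> A"
    using \<open>X \<subseteq> A\<close> \<open>Y \<subseteq> A\<close> by blast
  ultimately show "p + p' \<in> (\<lambda>X x. \<Sum>i\<in>X. m i x) ` Pow A"
    by blast
qed auto

lemma additive_linear_forms: "additive_family (linear_forms n)"
  unfolding linear_forms_def by (rule additive_family_subset_sums) simp

lemma additive_polynomials: "additive_family (polynomials d n)"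
  unfolding polynomials_def
  by (rule additive_family_subset_sums) (auto intro: finite_PiE)

lemma sum_bit_coeff:
  fixes a m :: "'a \<Rightarrow> bit"
  assumes "finite A"
  shows "(\<Sum>i\<in>A. a i * m i) = (\<Sum>i\<in>{i \<in> A. a i = 1}. m i)"
proof -
  have "(\<Sum>i\<in>{i \<in> A. a i = 1}. m i) = (\<Sum>i\<in>A. if a i = 1 then m i else 0)"
    by (rule sum.inter_filter[OF assms])
  also have "\<dots> = (\<Sum>i\<in>A. a i * m i)"
    by (intro sum.cong refl) auto
  finally show ?thesis ..
qed

lemma linear_formsI: "(\<lambda>x. \<Sum>i\<in>{1..n}. a i * x i) \<in> linear_forms n"
  unfolding linear_forms_def by (subst sum_bit_coeff) auto

text \<open>Expanding the product gives the tuple \<open>I\<close> the coefficient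
  \<open>\<Prod>l\<in>{1..d}. a l (I l)\<close>; the tuples with coefficient 1 form the set
  \<open>X\<close>.\<close>

lemma prod_linear_forms_in_polynomials:
  "(\<lambda>x. \<Prod>l\<in>{1..d}. \<Sum>i\<in>{1..n}. a l i * x i) \<in> polynomials d n"
proof -
  let ?A = "{1..d} \<rightarrow>\<^sub>E {1..n}"
  have "(\<Prod>l\<in>{1..d}. \<Sum>i\<in>{1..n}. a l i * x i)
      = (\<Sum>I\<in>{I\<in>?A. (\<Prod>l\<in>{1..d}. a l (I l)) = 1}. \<Prod>l\<in>{1..d}. x (I l))" for x :: point
    by (subst prod_sum_PiE) (auto simp: prod.distrib finite_PiE intro!: sum_bit_coeff)
  then show ?thesis
    unfolding polynomials_def by auto
qed

lemma bit_power [simp]: "d \<ge> 1 \<Longrightarrow> (b::bit) ^ d = b"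
  by (cases b) auto

lemma linear_forms_subset_polynomials:
  assumes "d \<ge> 1"
  shows "linear_forms n \<subseteq> polynomials d n"
proof
  fix p assume "p \<in> linear_forms n"
  then obtain S where S: "S \<subseteq> {1..n}" and p: "p = (\<lambda>x. \<Sum>i\<in>S. x i)"
    by (auto simp: linear_forms_def)
  \<comment> \<open>A bit equals its \<open>d\<close>-th power, so the form is a product of
    \<open>d\<close> copies of itself.\<close>
  have "p x = (\<Prod>l\<in>{1..d}. \<Sum>i\<in>{1..n}. of_bool (i \<in> S) * x i)" for x
  proof -
    have "(\<Sum>i\<in>{1..n}. of_bool (i \<in> S) * x i) = (\<Sum>i\<in>{i \<in> {1..n}. of_bool (i \<in> S) = (1::bit)}. x i)"
      by (rule sum_bit_coeff) simp
    also have "{i \<in> {1..n}. of_bool (i \<in> S) = (1::bit)} = S"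
      using S by auto
    finally show ?thesis
      using assms p by simp
  qed
  then have "p = (\<lambda>x. \<Prod>l\<in>{1..d}. \<Sum>i\<in>{1..n}. of_bool (i \<in> S) * x i)"
    by blast
  then show "p \<in> polynomials d n"
    using prod_linear_forms_in_polynomials[where a = "\<lambda>_ i. of_bool (i \<in> S)"] by simp
qed

lemma linear_function_linear_form:
  assumes "p \<in> linear_forms n"
  shows "linear_function n (bit_sign \<circ> p)"
proof -
  obtain S where S: "S \<subseteq> {1..n}" and p: "p = (\<lambda>x. \<Sum>i\<in>S. x i)"
    using assms by (auto simp: linear_forms_def)
  have "bit_sign (p x) = (-1) ^ (\<Sum>i\<in>S. of_bit (x i))" for x
    unfolding p sign_sum by (simp only: power_sum bit_sign_def)
  then show ?thesis
    using S by (auto simp: linear_function_def)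
qed

lemma boolean_function_sign: "boolean_function n (bit_sign \<circ> p)"
  using sign_values by (auto simp: boolean_function_def)

section \<open>Answers to a list of queries\<close>

text \<open>Evaluation at a list of points is additive, so all its nonempty fibres have the size of the
  kernel.\<close>

lemma card_eval:
  assumes "additive_family P"
  shows "card {p \<in> P. D (map p Q)}
    = card {v \<in> (\<lambda>p. map p Q) ` P. D v} * card {p \<in> P. \<forall>z\<in>set Q. p z = 0}"
proof -
  let ?K = "{p \<in> P. \<forall>z\<in>set Q. p z = 0}" and ?V = "{v \<in> (\<lambda>p. map p Q) ` P. D v}"
  have fin: "finite P" and add: "\<And>p p'. p \<in> P \<Longrightarrow> p' \<in> P \<Longrightarrow> p + p' \<in> P"
    using assms by (auto simp: additive_family_def)
  have fibre: "card {p \<in> P. map p Q = v} = card ?K" if "v \<in> ?V" for v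
  proof -
    obtain p0 where p0: "p0 \<in> P" "v = map p0 Q"
      using \<open>v \<in> ?V\<close> by auto
    have "bij_betw (\<lambda>p. p0 + p) {p \<in> P. map p Q = v} ?K"
      by (rule bij_betwI[where g = "\<lambda>p. p0 + p"]) (auto simp: p0 add bit_add_eq_0_iff)
    then show ?thesis
      by (rule bij_betw_same_card)
  qed
  have "{p \<in> P. D (map p Q)} = (\<Union>v\<in>?V. {p \<in> P. map p Q = v})"
    by (auto simp del: map_eq_conv)
  also have "card \<dots> = (\<Sum>v\<in>?V. card {p \<in> P. map p Q = v})"
    using fin by (intro card_UN_disjoint) auto
  also have "\<dots> = card ?V * card ?K"
    using fibre by simp
  finally show ?thesis .
qed

text \<open>All realized answer vectors are equally frequent, so an acceptance frequency is the
  share of accepted vectors. Passing from \<open>L\<close> to \<open>P\<close> can only add accepted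
  vectors; the loss is the ratio of the denominators.\<close>

lemma card_eval_compare:
  assumes P: "additive_family P" and L: "additive_family L" and sub: "L \<subseteq> P"
  shows "real (card {p \<in> L. D (map p Q)}) / card L
           * (card ((\<lambda>p. map p Q) ` L) / card ((\<lambda>p. map p Q) ` P))
    \<le> card {p \<in> P. D (map p Q)} / card P"
proof -
  let ?e = "\<lambda>p. map p Q"
  have fin: "finite P" "finite L" "P \<noteq> {}" "L \<noteq> {}"
    using P L by (auto simp: additive_family_def)
  have ratio: "real (card {p \<in> R. D (map p Q)}) / card R
      = card {v \<in> ?e ` R. D v} / card (?e ` R)" if "additive_family R" for R
  proof -
    have "finite R" "R \<noteq> {}"
      using that by (auto simp: additive_family_def)
    then have "card R > 0"
      by (simp add: card_gt_0_iff)
    \<comment> \<open>With the constantly true predicate, \<open>card_eval\<close> counts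
      \<open>R\<close> itself; the kernel size then cancels in the quotient.\<close>
    moreover have "card R = card (?e ` R) * card {p \<in> R. \<forall>z\<in>set Q. p z = 0}"
      using card_eval[OF that, of "\<lambda>_. True" Q] by (simp add: image_def)
    ultimately show ?thesis
      using card_eval[OF that, of D Q] by simp
  qed
  have "card {v \<in> ?e ` L. D v} \<le> card {v \<in> ?e ` P. D v}"
    using sub fin by (intro card_mono) auto
  moreover have "card (?e ` L) > 0"
    using fin by (simp add: card_gt_0_iff)
  ultimately show ?thesis
    unfolding ratio[OF P] ratio[OF L] by (simp add: divide_right_mono)
qed

lemma card_map_le_two_power:
  "card ((\<lambda>p. map p Q) ` P) \<le> 2 ^ length Q" for P :: "(point \<Rightarrow> bit) set"
proof -
  have "(\<lambda>p. map p Q) ` P \<subseteq> {xs :: bit list. set xs \<subseteq> UNIV \<and> length xs = length Q}"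
    by auto
  then have "card ((\<lambda>p. map p Q) ` P) \<le> card {xs :: bit list. set xs \<subseteq> UNIV \<and> length xs = length Q}"
    using finite_lists_length_eq[OF finite_UNIV_bit, of "length Q"] by (intro card_mono) auto
  then show ?thesis
    using card_lists_length_eq[OF finite_UNIV_bit, of "length Q"] by (simp add: card_UNIV_bit)
qed

text \<open>Values on an independent set of queries can be prescribed freely by a linear
  form.\<close>

lemma linear_forms_realize:
  assumes "point.independent B" "B \<subseteq> set Q" "set Q \<subseteq> cube n"
  shows "2 ^ card B \<le> card ((\<lambda>p. map p Q) ` linear_forms n)"
proof -
  \<comment> \<open>A point may be queried several times; \<open>?h\<close> reads the answer at its
    first position.\<close>
  let ?h = "\<lambda>v. restrict (\<lambda>b. v ! (LEAST i. i < length Q \<and> Q ! i = b)) B"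
  have fB: "finite B"
    using assms(2) finite_subset by blast
  have h: "?h (map p Q) = restrict p B" for p :: "point \<Rightarrow> bit"
  proof
    fix b
    show "?h (map p Q) b = restrict p B b"
    proof (cases "b \<in> B")
      case True
      then obtain j where "j < length Q \<and> Q ! j = b"
        using assms(2) by (metis in_set_conv_nth subsetD)
      from LeastI[of "\<lambda>i. i < length Q \<and> Q ! i = b", OF this] True show ?thesis
        by simp
    qed simp
  qed
  have "(B \<rightarrow>\<^sub>E (UNIV :: bit set)) \<subseteq> ?h ` (\<lambda>p. map p Q) ` linear_forms n"
  proof
    fix g :: "point \<Rightarrow> bit" assume g: "g \<in> B \<rightarrow>\<^sub>E UNIV"
    obtain a where a: "\<And>x. x \<in> B \<inter> cube n \<Longrightarrow> (\<Sum>i\<in>{1..n}. a i * x i) = g x"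
      using functional_extension[OF assms(1)] by metis
    let ?p = "\<lambda>x :: point. \<Sum>i\<in>{1..n}. a i * x i"
    have "restrict ?p B = g"
      using a assms g by (auto simp: fun_eq_iff PiE_def extensional_def restrict_def subset_iff)
    then have "g = ?h (map ?p Q)"
      using h[of ?p] by simp
    then show "g \<in> ?h ` (\<lambda>p. map p Q) ` linear_forms n"
      using linear_formsI[where n = n and a = a] by blast
  qed
  moreover have "finite ((\<lambda>p. map p Q) ` linear_forms n)"
    using additive_linear_forms by (simp add: additive_family_def)
  ultimately have "card (B \<rightarrow>\<^sub>E (UNIV :: bit set)) \<le> card ((\<lambda>p. map p Q) ` linear_forms n)"
    by (meson card_image_le card_mono finite_imageI le_trans)
  then show ?thesis
    using fB by (simp add: card_PiE card_UNIV_bit)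
qed

text \<open>Expanding the queries in a basis \<open>B\<close>, the values of a polynomial on all queries are
  determined by the contractions of its coefficient tensor with the \<open>card B ^ d\<close> tuples from \<open>B\<close>.\<close>

lemma polynomials_realize_le:
  assumes "finite B" "set Q \<subseteq> point.span B"
  shows "card ((\<lambda>p. map p Q) ` polynomials d n) \<le> 2 ^ (card B ^ d)"
proof -
  let ?K = "{1..d} \<rightarrow>\<^sub>E B"
  have "\<exists>c. x = (\<Sum>b\<in>B. (\<lambda>i. c b * b i))" if "x \<in> set Q" for x
    using that assms(2) unfolding point.span_finite[OF assms(1)] by auto
  then obtain c where c: "\<And>x. x \<in> set Q \<Longrightarrow> x = (\<Sum>b\<in>B. (\<lambda>i. c x b * b i))"
    by metis
  \<comment> \<open>\<open>G\<close> rebuilds the answers from a table \<open>t\<close> indexed by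
    tuples of basis points, weighted by products of the coordinates \<open>c x b\<close>.\<close>
  define G where "G = (\<lambda>t. map (\<lambda>x. \<Sum>K\<in>?K. (\<Prod>l\<in>{1..d}. c x (K l)) * t K) Q)"
  have finK: "finite ?K"
    using assms(1) by (simp add: finite_PiE)
  have "(\<lambda>p. map p Q) ` polynomials d n \<subseteq> G ` (?K \<rightarrow>\<^sub>E (UNIV :: bit set))"
  proof
    fix v assume "v \<in> (\<lambda>p. map p Q) ` polynomials d n"
    then obtain X where X: "X \<subseteq> {1..d} \<rightarrow>\<^sub>E {1..n}"
      and v: "v = map (\<lambda>x. \<Sum>I\<in>X. \<Prod>l\<in>{1..d}. x (I l)) Q"
      by (auto simp: polynomials_def)
    define t where "t = (\<lambda>K\<in>?K. \<Sum>I\<in>X. \<Prod>l\<in>{1..d}. K l (I l))"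
    have "(\<Sum>I\<in>X. \<Prod>l\<in>{1..d}. x (I l)) = (\<Sum>K\<in>?K. (\<Prod>l\<in>{1..d}. c x (K l)) * t K)"
      if x: "x \<in> set Q" for x
    proof -
      have coord: "x j = (\<Sum>b\<in>B. c x b * b j)" for j
        using fun_cong[OF c[OF x], of j] by (simp only: sum_fun_apply)
      have "(\<Sum>I\<in>X. \<Prod>l\<in>{1..d}. x (I l)) = (\<Sum>I\<in>X. \<Prod>l\<in>{1..d}. \<Sum>b\<in>B. c x b * b (I l))"
        by (intro sum.cong prod.cong refl coord)
      also have "\<dots> = (\<Sum>I\<in>X. \<Sum>K\<in>?K. \<Prod>l\<in>{1..d}. c x (K l) * K l (I l))"
        using assms(1) by (intro sum.cong refl prod_sum_PiE) auto
      also have "\<dots> = (\<Sum>K\<in>?K. \<Sum>I\<in>X. \<Prod>l\<in>{1..d}. c x (K l) * K l (I l))"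
        by (rule sum.swap)
      also have "\<dots> = (\<Sum>K\<in>?K. (\<Prod>l\<in>{1..d}. c x (K l)) * t K)"
        by (intro sum.cong refl) (simp add: t_def prod.distrib sum_distrib_left)
      finally show ?thesis .
    qed
    then have "v = G t"
      unfolding v G_def by (intro map_cong refl) simp
    moreover have "t \<in> ?K \<rightarrow>\<^sub>E UNIV"
      by (simp add: t_def)
    ultimately show "v \<in> G ` (?K \<rightarrow>\<^sub>E UNIV)"
      by blast
  qed
  moreover have "finite (?K \<rightarrow>\<^sub>E (UNIV :: bit set))"
    using finK finite_UNIV_bit by (simp add: finite_PiE)
  ultimately have "card ((\<lambda>p. map p Q) ` polynomials d n) \<le> card (?K \<rightarrow>\<^sub>E (UNIV :: bit set))"
    by (meson card_image_le card_mono finite_imageI le_trans)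
  also have "\<dots> = 2 ^ (card B ^ d)"
    using finK by (simp add: card_PiE card_UNIV_bit)
  finally show ?thesis .
qed

section \<open>Optimizing over the rank of the queries\<close>

text \<open>Let \<open>u\<close> be the \<open>d\<close>-th root of \<open>q\<close>. A rank
  \<open>r\<close> of at least \<open>u / 2\<close> suffices through the subtracted
  \<open>r\<close>; below that, \<open>r ^ d\<close> is at most \<open>q / 2 ^ d\<close>, hence at
  most a quarter of \<open>q\<close>.\<close>

lemma rank_tradeoff:
  fixes d q r :: nat
  assumes d: "d \<ge> 2" and q: "q \<ge> 1"
  shows "min (real q) (real r ^ d) - real r \<le> real q - 1/2 * real q powr (1 / real d)"
proof -
  define u where "u = real q powr (1 / real d)"
  have u1: "1 \<le> u"
    using q by (simp add: u_def ge_one_powr_ge_zero)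
  have ud: "u ^ d = real q"
    using q d by (simp add: u_def powr_powr flip: powr_realpow)
  show ?thesis
  proof (cases "real r \<ge> u / 2")
    case True
    then show ?thesis
      by (auto simp: u_def)
  next
    case False
    have "u ^ 2 \<le> u ^ d"
      using u1 d by (intro power_increasing) auto
    then have uq: "u ^ 2 \<le> q"
      by (simp add: ud)
    show ?thesis
    proof (cases "r = 0")
      case True
      have "u \<le> u\<^sup>2"
        using u1 by (simp add: power2_eq_square)
      then have "u \<le> 2 * real q"
        using uq by linarith
      then show ?thesis
        using True d by (simp add: u_def power_0_left)
    next
      case r: False
      have "real r ^ d \<le> (u / 2) ^ d"
        using False by (intro power_mono) auto
      also have "\<dots> = real q / 2 ^ d"
        by (simp add: power_divide ud)
      also have "\<dots> \<le> real q / 2 ^ 2"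
        using d by (intro divide_left_mono power_increasing) auto
      finally have "real r ^ d \<le> real q / 4"
        by simp
      \<comment> \<open>The remaining three quarters of \<open>q\<close> absorb
        \<open>u / 2\<close>, since \<open>u \<le> u ^ 2 \<le> q\<close>.\<close>
      moreover have "u / 2 \<le> 3 / 4 * real q + real r"
      proof -
        have "u \<le> u\<^sup>2"
          using u1 by (simp add: power2_eq_square)
        then show ?thesis
          using uq by linarith
      qed
      ultimately show ?thesis
        by (simp add: u_def)
    qed
  qed
qed

text \<open>A basis \<open>B\<close> chosen among the queries bounds both counts through its size,
  from below for linear forms and from above for polynomials; \<open>rank_tradeoff\<close> then
  eliminates that size.\<close>

lemma polynomials_linear_forms_ratio:
  assumes d: "d \<ge> 2" and q: "q \<ge> 1" and Q: "length Q = q" "set Q \<subseteq> cube n"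
  shows "2 powr (- real q + 1/2 * real q powr (1 / real d))
    \<le> card ((\<lambda>p. map p Q) ` linear_forms n) / card ((\<lambda>p. map p Q) ` polynomials d n)"
proof -
  obtain B where B: "B \<subseteq> set Q" "point.independent B" "set Q \<subseteq> point.span B"
    using point.maximal_independent_subset by blast
  let ?l = "card ((\<lambda>p. map p Q) ` linear_forms n)" and ?p = "card ((\<lambda>p. map p Q) ` polynomials d n)"
  have fB: "finite B"
    using B(1) finite_subset by blast
  have l: "2 powr real (card B) \<le> ?l"
    using linear_forms_realize[OF B(2,1) Q(2)]
    by (metis of_nat_le_iff of_nat_numeral of_nat_power powr_realpow zero_less_numeral)
  have p1: "real ?p \<le> 2 powr real q"
    using card_map_le_two_power[of Q "polynomials d n"] Q(1)
    by (metis of_nat_le_iff of_nat_numeral of_nat_power powr_realpow zero_less_numeral)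
  have p2: "real ?p \<le> 2 powr (real (card B) ^ d)"
    using polynomials_realize_le[OF fB B(3), of d n]
    by (metis of_nat_le_iff of_nat_numeral of_nat_power powr_realpow zero_less_numeral)
  have p: "real ?p \<le> 2 powr (min (real q) (real (card B) ^ d))"
    using p1 p2 by (simp add: min_def)
  have p0: "?p > 0"
    using additive_polynomials[of d n] by (simp add: additive_family_def card_gt_0_iff)
  have "2 powr (- real q + 1/2 * real q powr (1 / real d))
      \<le> 2 powr (real (card B) - min (real q) (real (card B) ^ d))"
    using rank_tradeoff[OF d q, of "card B"] by (intro powr_mono) auto
  also have "\<dots> = 2 powr real (card B) / 2 powr (min (real q) (real (card B) ^ d))"
    by (rule powr_diff)
  also have "\<dots> \<le> real ?l / real ?p"
    using l p p0 by (intro frac_le) auto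
  finally show ?thesis .
qed

section \<open>Gowers uniformity of random polynomials\<close>

text \<open>The support of the \<open>Pi_pmf\<close> in the uniformity, with the same default 0, so
  that expectations become finite sums.\<close>

abbreviation directions :: "nat \<Rightarrow> nat \<Rightarrow> (nat \<Rightarrow> point) set" where
  "directions d n \<equiv> PiE_dflt {1..d} 0 (\<lambda>_. cube n)"

lemma finite_directions: "finite (directions d n)"
  by (simp add: finite_PiE_dflt)

lemma directions_nonempty: "directions d n \<noteq> {}"
  by (auto simp: PiE_dflt_def intro!: exI[of _ 0])

lemma directions_shift:
  "k \<in> {1..d} \<Longrightarrow> z \<in> cube n \<Longrightarrow> y \<in> directions d n \<Longrightarrow> y(k := y k + z) \<in> directions d n"
  by (auto simp: PiE_dflt_def)

lemma pair_pmf_of_set: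
  assumes "finite A" "A \<noteq> {}" "finite B" "B \<noteq> {}"
  shows "pair_pmf (pmf_of_set A) (pmf_of_set B) = pmf_of_set (A \<times> B)"
proof (rule pmf_eqI)
  fix z
  show "pmf (pair_pmf (pmf_of_set A) (pmf_of_set B)) z = pmf (pmf_of_set (A \<times> B)) z"
    using assms by (cases z) (auto simp: pmf_pair card_cartesian_product indicator_def)
qed

lemma gowers_uniformity_eq_sum:
  "gowers_uniformity d n f =
    (\<Sum>(x, y)\<in>cube n \<times> directions d n. \<Prod>S\<in>Pow {1..d}. f (x + (\<Sum>i\<in>S. y i)))
      / (card (cube n) * card (directions d n))"
proof -
  have "Pi_pmf {1..d} 0 (\<lambda>_. pmf_of_set (cube n)) = pmf_of_set (directions d n)"
    by (rule Pi_pmf_of_set) auto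
  moreover have "pair_pmf (pmf_of_set (cube n)) (pmf_of_set (directions d n))
      = pmf_of_set (cube n \<times> directions d n)"
    using finite_directions[of d n] directions_nonempty[of d n] by (simp add: pair_pmf_of_set)
  ultimately show ?thesis
    unfolding gowers_uniformity_def
    using finite_directions[of d n] directions_nonempty[of d n]
    by (simp add: integral_pmf_of_set card_cartesian_product)
qed

lemma bij_betw_cube_add: "z \<in> cube n \<Longrightarrow> bij_betw ((+) z) (cube n) (cube n)"
  by (rule bij_betwI[where g = "(+) z"]) (auto simp: add_in_cube)

lemma sum_cube_shift: "z \<in> cube n \<Longrightarrow> (\<Sum>x\<in>cube n. g (z + x)) = (\<Sum>x\<in>cube n. g x)"
  by (rule sum.reindex_bij_betw[OF bij_betw_cube_add])

lemma bij_betw_directions_shift: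
  assumes "k \<in> {1..d}" "z \<in> cube n"
  shows "bij_betw (\<lambda>y. y(k := y k + z)) (directions d n) (directions d n)"
  using directions_shift[OF assms]
  by (intro bij_betwI[where g = "\<lambda>y. y(k := y k + z)"]) (auto simp: add.assoc)

text \<open>Averaging the last direction over a uniform shift exhibits each inner average as a square.\<close>

lemma gowers_uniformity_nonneg:
  assumes "d \<ge> 1"
  shows "0 \<le> gowers_uniformity d n f"
proof -
  let ?G = "\<lambda>x y. \<Prod>S\<in>Pow {1..d}. f (x + (\<Sum>i\<in>S. y i))"
  \<comment> \<open>\<open>h y\<close> collects the factors with \<open>d \<notin> S\<close>; those
    with \<open>d \<in> S\<close> are the same factors at \<open>x + y d\<close>.\<close>
  define h where "h = (\<lambda>y x. \<Prod>S\<in>Pow {1..d - 1}. f (x + (\<Sum>i\<in>S. y i)))"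
  have dset: "{1..d} = insert d {1..d - 1}"
    using assms by auto
  have G: "?G x y = h y x * h y (x + y d)" for x y
  proof -
    have "?G x y = (\<Prod>S\<in>Pow {1..d - 1} \<union> insert d ` Pow {1..d - 1}. f (x + (\<Sum>i\<in>S. y i)))"
      by (simp only: dset Pow_insert)
    also have "\<dots> = h y x * (\<Prod>S\<in>insert d ` Pow {1..d - 1}. f (x + (\<Sum>i\<in>S. y i)))"
      unfolding h_def by (rule prod.union_disjoint) (use assms in auto)
    also have "(\<Prod>S\<in>insert d ` Pow {1..d - 1}. f (x + (\<Sum>i\<in>S. y i)))
        = (\<Prod>S\<in>Pow {1..d - 1}. f (x + (\<Sum>i\<in>insert d S. y i)))"
    proof (subst prod.reindex)
      have "d \<notin> S" if "S \<in> Pow {1..d - 1}" for S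
        using that assms by auto
      then show "inj_on (insert d) (Pow {1..d - 1})"
        by (intro inj_onI) (metis insert_ident)
    qed simp
    also have "\<dots> = h y (x + y d)"
      unfolding h_def
    proof (rule prod.cong)
      fix S assume "S \<in> Pow {1..d - 1}"
      then have "finite S" "d \<notin> S"
        using assms by (auto intro: finite_subset)
      then show "f (x + (\<Sum>i\<in>insert d S. y i)) = f (x + y d + (\<Sum>i\<in>S. y i))"
        by (simp add: add.assoc)
    qed simp
    finally show ?thesis .
  qed
  \<comment> \<open>The direction \<open>y d\<close> does not enter \<open>h y\<close>, so shifting
    it affects only the second factor of \<open>?G\<close>.\<close>
  have h_upd: "h (y(d := v)) = h y" for y v
    unfolding h_def using assms
    by (intro ext prod.cong refl arg_cong[of _ _ f] arg_cong2[of _ _ _ _ "(+)"] sum.cong) auto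
  have "card (cube n) * (\<Sum>(x, y)\<in>cube n \<times> directions d n. ?G x y)
      = (\<Sum>z\<in>cube n. \<Sum>x\<in>cube n. \<Sum>y\<in>directions d n. ?G x y)"
    by (simp add: sum.cartesian_product)
  also have "\<dots> = (\<Sum>z\<in>cube n. \<Sum>x\<in>cube n. \<Sum>y\<in>directions d n. ?G x (y(d := y d + z)))"
    using assms
    by (intro sum.cong refl sum.reindex_bij_betw[OF bij_betw_directions_shift, symmetric]) auto
  also have "\<dots> = (\<Sum>y\<in>directions d n. \<Sum>x\<in>cube n. \<Sum>z\<in>cube n. h y x * h y ((x + y d) + z))"
  proof -
    let ?g = "\<lambda>z x y. h y x * h y ((x + y d) + z)"
    have "?G x (y(d := y d + z)) = ?g z x y" for x y z
      unfolding G h_upd by (simp only: fun_upd_same add.assoc)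
    then have "(\<Sum>z\<in>cube n. \<Sum>x\<in>cube n. \<Sum>y\<in>directions d n. ?G x (y(d := y d + z)))
        = (\<Sum>z\<in>cube n. \<Sum>x\<in>cube n. \<Sum>y\<in>directions d n. ?g z x y)"
      by (simp only:)
    also have "\<dots> = (\<Sum>z\<in>cube n. \<Sum>y\<in>directions d n. \<Sum>x\<in>cube n. ?g z x y)"
      by (intro sum.cong refl sum.swap)
    also have "\<dots> = (\<Sum>y\<in>directions d n. \<Sum>z\<in>cube n. \<Sum>x\<in>cube n. ?g z x y)"
      by (rule sum.swap)
    also have "\<dots> = (\<Sum>y\<in>directions d n. \<Sum>x\<in>cube n. \<Sum>z\<in>cube n. ?g z x y)"
      by (intro sum.cong refl sum.swap)
    finally show ?thesis .
  qed
  \<comment> \<open>As \<open>z\<close> runs over the cube, so does \<open>x + y d + z\<close>; the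
    sum over \<open>z\<close> therefore does not depend on \<open>x\<close>.\<close>
  also have "\<dots> = (\<Sum>y\<in>directions d n. (\<Sum>x\<in>cube n. h y x)\<^sup>2)"
  proof (rule sum.cong)
    fix y assume y: "y \<in> directions d n"
    then have "y d \<in> cube n"
      using assms by (auto simp: PiE_dflt_def)
    then have "(\<Sum>z\<in>cube n. h y ((x + y d) + z)) = (\<Sum>z\<in>cube n. h y z)" if "x \<in> cube n" for x
      using that by (intro sum_cube_shift add_in_cube)
    then show "(\<Sum>x\<in>cube n. \<Sum>z\<in>cube n. h y x * h y ((x + y d) + z)) = (\<Sum>x\<in>cube n. h y x)\<^sup>2"
      by (simp add: power2_eq_square sum_distrib_right flip: sum_distrib_left)
  qed simp
  also have "\<dots> \<ge> 0"
    by (intro sum_nonneg) simp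
  finally have "0 \<le> card (cube n) * (\<Sum>(x, y)\<in>cube n \<times> directions d n. ?G x y)" .
  moreover have "0 < real (card (cube n))"
    by (simp add: card_cube)
  ultimately have "0 \<le> (\<Sum>(x, y)\<in>cube n \<times> directions d n. ?G x y)"
    by (meson mult_pos_neg not_le)
  then show ?thesis
    unfolding gowers_uniformity_eq_sum by (rule divide_nonneg_nonneg) simp
qed

section \<open>Cancellation for independent directions\<close>

text \<open>Translation by \<open>p0\<close> permutes \<open>P\<close> and flips every sign, so the
  sum equals its own negative.\<close>

lemma sum_sign_additive:
  assumes P: "additive_family P" and h: "\<And>p p'. h (p + p') = h p + h p'"
    and p0: "p0 \<in> P" "h p0 = 1"
  shows "(\<Sum>p\<in>P. bit_sign (h p)) = 0"
proof -
  have "bij_betw ((+) p0) P P"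
    using P p0(1) by (intro bij_betwI[where g = "(+) p0"]) (auto simp: additive_family_def)
  then have "(\<Sum>p\<in>P. bit_sign (h p)) = (\<Sum>p\<in>P. bit_sign (h (p0 + p)))"
    by (rule sum.reindex_bij_betw[symmetric])
  also have "\<dots> = - (\<Sum>p\<in>P. bit_sign (h p))"
    by (simp add: h p0(2) sign_add sum_negf)
  finally show ?thesis
    by simp
qed

text \<open>Over the two-element field a linear combination is a subset sum. Injectivity comes from
  sets of two indices, as equal directions would cancel.\<close>

lemma independent_directions:
  fixes d :: nat
  assumes "\<And>S. S \<subseteq> {1..d} \<Longrightarrow> S \<noteq> {} \<Longrightarrow> (\<Sum>i\<in>S. y i) \<noteq> (0 :: point)"
  shows "inj_on y {1..d}" "point.independent (y ` {1..d})"
proof -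
  show inj: "inj_on y {1..d}"
  proof (rule inj_onI, rule ccontr)
    fix i j assume "i \<in> {1..d}" "j \<in> {1..d}" "y i = y j" "i \<noteq> j"
    then show False
      using assms[of "{i, j}"] by simp
  qed
  show "point.independent (y ` {1..d})"
  proof (rule point.independent_if_scalars_zero)
    fix c :: "point \<Rightarrow> bit" and x
    assume c: "(\<Sum>x\<in>y ` {1..d}. (\<lambda>i. c x * x i)) = 0" and x: "x \<in> y ` {1..d}"
    let ?S = "{k \<in> {1..d}. c (y k) = 1}"
    have "(\<Sum>k\<in>?S. y k) = (\<Sum>x\<in>y ` {1..d}. (\<lambda>i. c x * x i))"
    proof
      fix i
      have "(\<Sum>k\<in>?S. y k) i = (\<Sum>k\<in>{1..d}. c (y k) * y k i)"
        by (subst sum_bit_coeff) (simp_all only: sum_fun_apply finite_atLeastAtMost)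
      also have "\<dots> = (\<Sum>x\<in>y ` {1..d}. (\<lambda>i. c x * x i)) i"
        by (simp only: sum_fun_apply sum.reindex[OF inj] o_def)
      finally show "(\<Sum>k\<in>?S. y k) i = (\<Sum>x\<in>y ` {1..d}. (\<lambda>i. c x * x i)) i" .
    qed
    then have "(\<Sum>k\<in>?S. y k) = 0"
      using c by (rule trans)
    then have "?S = {}"
      using assms[of ?S] by blast
    then have "c (y k) \<noteq> 1" if "k \<in> {1..d}" for k
      using that by blast
    then show "c x = 0"
      using x by auto
  qed simp
qed

text \<open>The witness is the product of the functionals dual to \<open>y\<close>: moving along \<open>y l\<close> flips
  only the \<open>l\<close>-th factor, so exactly one \<open>S\<close> makes all factors equal to 1.\<close>

lemma polynomial_with_derivative_one:
  assumes y: "y \<in> directions d n"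
    and indep: "\<And>S. S \<subseteq> {1..d} \<Longrightarrow> S \<noteq> {} \<Longrightarrow> (\<Sum>i\<in>S. y i) \<noteq> 0"
  obtains p where "p \<in> polynomials d n" "\<And>x. (\<Sum>S\<in>Pow {1..d}. p (x + (\<Sum>i\<in>S. y i))) = 1"
proof -
  have "\<exists>a :: nat \<Rightarrow> bit. \<forall>k\<in>{1..d}. (\<Sum>i\<in>{1..n}. a i * y k i) = of_bool (k = l)"
    if "l \<in> {1..d}" for l
  proof -
    \<comment> \<open>The functional dual to \<open>y l\<close>; injectivity of \<open>y\<close>
      later turns \<open>y k = y l\<close> into \<open>k = l\<close>.\<close>
    obtain a :: "nat \<Rightarrow> bit" where a: "\<And>x. x \<in> y ` {1..d} \<inter> cube n \<Longrightarrow>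
        (\<Sum>i\<in>{1..n}. a i * x i) = of_bool (x = y l)"
      using functional_extension[OF independent_directions(2)[of d y, OF indep],
        where n = n and g = "\<lambda>x. of_bool (x = y l)"] by metis
    have "(\<Sum>i\<in>{1..n}. a i * y k i) = of_bool (k = l)" if "k \<in> {1..d}" for k
    proof -
      have "y k \<in> cube n"
        using y that by (auto simp: PiE_dflt_def)
      then have "(\<Sum>i\<in>{1..n}. a i * y k i) = of_bool (y k = y l)"
        using a that by blast
      also have "(y k = y l) = (k = l)"
        using independent_directions(1)[of d y, OF indep] that \<open>l \<in> {1..d}\<close> by (auto dest: inj_onD)
      finally show ?thesis .
    qed
    then show ?thesis
      by blast
  qed
  then obtain a :: "nat \<Rightarrow> nat \<Rightarrow> bit" where
    a: "\<And>l k. l \<in> {1..d} \<Longrightarrow> k \<in> {1..d} \<Longrightarrow> (\<Sum>i\<in>{1..n}. a l i * y k i) = of_bool (k = l)"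
    by metis
  define \<phi> where "\<phi> = (\<lambda>l (x :: point). \<Sum>i\<in>{1..n}. a l i * x i)"
  have \<phi>_add: "\<phi> l (x + x') = \<phi> l x + \<phi> l x'" for l x x'
    by (simp add: \<phi>_def distrib_left sum.distrib)
  have \<phi>_y: "\<phi> l (\<Sum>i\<in>S. y i) = of_bool (l \<in> S)" if "l \<in> {1..d}" "S \<subseteq> {1..d}" for l S
  proof -
    have "finite S"
      using that(2) finite_subset by blast
    then show ?thesis
      using that(2)
    proof (induction S rule: finite_induct)
      case empty
      then show ?case
        by (simp add: \<phi>_def)
    next
      case (insert k S)
      have "\<phi> l (\<Sum>i\<in>insert k S. y i) = \<phi> l (y k) + \<phi> l (\<Sum>i\<in>S. y i)"
        by (subst sum.insert[OF insert.hyps]) (rule \<phi>_add)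
      also have "\<dots> = of_bool (k = l) + of_bool (l \<in> S)"
        using insert a[OF that(1), of k] by (simp add: \<phi>_def)
      also have "\<dots> = of_bool (l \<in> insert k S)"
        using insert.hyps by auto
      finally show ?case .
    qed
  qed
  show ?thesis
  proof (rule that)
    show "(\<lambda>x. \<Prod>l\<in>{1..d}. \<phi> l x) \<in> polynomials d n"
      unfolding \<phi>_def by (rule prod_linear_forms_in_polynomials)
    fix x
    have "(\<Sum>S\<in>Pow {1..d}. \<Prod>l\<in>{1..d}. \<phi> l (x + (\<Sum>i\<in>S. y i)))
        = (\<Sum>S\<in>Pow {1..d}. (\<Prod>l\<in>S. \<phi> l x + 1) * (\<Prod>l\<in>{1..d} - S. \<phi> l x))"
    proof (rule sum.cong)
      fix S assume S: "S \<in> Pow {1..d}"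
      have "(\<Prod>l\<in>{1..d}. \<phi> l (x + (\<Sum>i\<in>S. y i)))
          = (\<Prod>l\<in>{1..d}. if l \<in> S then \<phi> l x + 1 else \<phi> l x)"
        using S by (intro prod.cong) (auto simp: \<phi>_add \<phi>_y)
      also have "\<dots> = (\<Prod>l\<in>S. \<phi> l x + 1) * (\<Prod>l\<in>{1..d} - S. \<phi> l x)"
        using S by (subst prod.If_cases)
          (auto simp: Int_absorb1 Diff_eq intro!: arg_cong2[of _ _ _ _ "(*)"] prod.cong)
      finally show "(\<Prod>l\<in>{1..d}. \<phi> l (x + (\<Sum>i\<in>S. y i)))
          = (\<Prod>l\<in>S. \<phi> l x + 1) * (\<Prod>l\<in>{1..d} - S. \<phi> l x)" .
    qed simp
    \<comment> \<open>The sum over \<open>S\<close> is the expansion of this product, each of whose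
      factors is 1 in characteristic 2.\<close>
    also have "\<dots> = (\<Prod>l\<in>{1..d}. (\<phi> l x + 1) + \<phi> l x)"
      by (rule prod_add[symmetric]) simp
    also have "\<dots> = 1"
      by (intro prod.neutral ballI) (simp add: add.commute)
    finally show "(\<Sum>S\<in>Pow {1..d}. \<Prod>l\<in>{1..d}. \<phi> l (x + (\<Sum>i\<in>S. y i))) = 1" .
  qed
qed

section \<open>Dependent directions and the average uniformity\<close>

text \<open>Shifting one coordinate \<open>k \<in> S\<close> of a solution by \<open>z\<close> makes
  its sum over \<open>S\<close> equal to \<open>z\<close>. Hence \<open>z\<close>, and then the
  solution, can be recovered, so the shift is injective on pairs.\<close>

lemma card_directions_relation:
  fixes S :: "nat set"
  assumes S: "S \<subseteq> {1..d}" "S \<noteq> {}"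
  shows "card {y \<in> directions d n. (\<Sum>i\<in>S. y i) = 0} * card (cube n) \<le> card (directions d n)"
proof -
  obtain k where k: "k \<in> S"
    using S(2) by blast
  have fS: "finite S"
    using S(1) finite_subset by blast
  let ?Z = "{y \<in> directions d n. (\<Sum>i\<in>S. y i) = 0}"
  let ?F = "\<lambda>(y :: nat \<Rightarrow> point, z). y(k := y k + z)"
  have sum_F: "(\<Sum>i\<in>S. (y(k := y k + z)) i) = (\<Sum>i\<in>S. y i) + z" for y :: "nat \<Rightarrow> point" and z
  proof -
    have "(\<Sum>i\<in>S - {k}. (y(k := y k + z)) i) = (\<Sum>i\<in>S - {k}. y i)"
      by (intro sum.cong) auto
    then show ?thesis
      using sum.remove[OF fS k, of y] sum.remove[OF fS k, of "y(k := y k + z)"]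
      by (simp add: add_ac)
  qed
  have "inj_on ?F (?Z \<times> cube n)"
  proof (rule inj_onI, clarify)
    fix y y' :: "nat \<Rightarrow> point" and z z' :: point
    assume eq: "y(k := y k + z) = y'(k := y' k + z')"
      and y: "(\<Sum>i\<in>S. y i) = 0" "(\<Sum>i\<in>S. y' i) = 0"
    have z: "z = z'"
      using sum_F[of y z] sum_F[of y' z'] y eq by simp
    have "y i = y' i" for i
      using fun_cong[OF eq, of i] z by (cases "i = k") auto
    then show "y = y' \<and> z = z'"
      using z by auto
  qed
  moreover have "?F ` (?Z \<times> cube n) \<subseteq> directions d n"
    using directions_shift k S(1) by auto
  ultimately have "card (?Z \<times> cube n) \<le> card (directions d n)"
    using finite_directions by (rule card_inj_on_le)
  then show ?thesis
    by (simp add: card_cartesian_product)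
qed

lemma card_dependent_directions:
  "card {y \<in> directions d n. \<exists>S\<subseteq>{1..d}. S \<noteq> {} \<and> (\<Sum>i\<in>S. y i) = 0}
    \<le> 2 ^ d / 2 ^ n * card (directions d n)"
proof -
  let ?Z = "\<lambda>S. {y \<in> directions d n. (\<Sum>i\<in>S. y i) = 0}"
  have "{y \<in> directions d n. \<exists>S\<subseteq>{1..d}. S \<noteq> {} \<and> (\<Sum>i\<in>S. y i) = 0} = (\<Union>S\<in>Pow {1..d} - {{}}. ?Z S)"
    by auto
  also have "real (card \<dots>) \<le> real (\<Sum>S\<in>Pow {1..d} - {{}}. card (?Z S))"
    by (intro of_nat_mono card_UN_le) simp
  also have "\<dots> = (\<Sum>S\<in>Pow {1..d} - {{}}. real (card (?Z S)))"
    by simp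
  also have "\<dots> \<le> (\<Sum>S\<in>Pow {1..d} - {{}}. card (directions d n) / 2 ^ n)"
  proof (rule sum_mono)
    fix S assume "S \<in> Pow {1..d} - {{}}"
    then have "card (?Z S) * card (cube n) \<le> card (directions d n)"
      by (intro card_directions_relation) auto
    then have "real (card (?Z S) * card (cube n)) \<le> real (card (directions d n))"
      by (rule of_nat_mono)
    then show "real (card (?Z S)) \<le> card (directions d n) / 2 ^ n"
      by (simp add: card_cube field_simps)
  qed
  \<comment> \<open>Union bound over nonempty \<open>S\<close>; including the empty set rounds the
    number of terms up to \<open>2 ^ d\<close>.\<close>
  also have "\<dots> \<le> (\<Sum>S\<in>Pow {1..d}. card (directions d n) / 2 ^ n)"
    by (intro sum_mono2) auto
  also have "\<dots> = 2 ^ d / 2 ^ n * card (directions d n)"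
    by (simp add: card_Pow)
  finally show ?thesis .
qed

text \<open>For fixed \<open>x\<close> and \<open>y\<close> the product of signs is the sign of the
  derivative \<open>h x y p\<close>, which is additive in \<open>p\<close>. Summed over
  \<open>p\<close> it vanishes when the directions are independent and is at most
  \<open>card ?P\<close> otherwise; dependent directions are rare.\<close>

lemma sum_gowers_polynomials:
  "(\<Sum>p\<in>polynomials d n. gowers_uniformity d n (bit_sign \<circ> p))
    \<le> 2 ^ d / 2 ^ n * card (polynomials d n)"
proof -
  let ?P = "polynomials d n" and ?Y = "directions d n"
  let ?bad = "{y \<in> ?Y. \<exists>S\<subseteq>{1..d}. S \<noteq> {} \<and> (\<Sum>i\<in>S. y i) = 0}"
  define h where "h = (\<lambda>x y (p :: point \<Rightarrow> bit). \<Sum>S\<in>Pow {1..d}. p (x + (\<Sum>i\<in>S. y i)))"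
  have char_sum: "(\<Sum>p\<in>?P. bit_sign (h x y p)) \<le> real (card ?P) * of_bool (y \<in> ?bad)" if y: "y \<in> ?Y" for x y
  proof (cases "y \<in> ?bad")
    case True
    have "(\<Sum>p\<in>?P. bit_sign (h x y p)) \<le> (\<Sum>p\<in>?P. 1)"
      using abs_sign by (intro sum_mono) (metis abs_le_D1 order_refl)
    then show ?thesis
      using True by simp
  next
    case False
    then have indep: "(\<Sum>i\<in>S. y i) \<noteq> 0" if "S \<subseteq> {1..d}" "S \<noteq> {}" for S
      using y that by blast
    obtain p0 where "p0 \<in> ?P" "\<And>x. (\<Sum>S\<in>Pow {1..d}. p0 (x + (\<Sum>i\<in>S. y i))) = 1"
      using polynomial_with_derivative_one[OF y indep] by metis
    then have "(\<Sum>p\<in>?P. bit_sign (h x y p)) = 0"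
      by (intro sum_sign_additive[OF additive_polynomials])
        (simp_all only: h_def sum.distrib plus_fun_apply)
    then show ?thesis
      by simp
  qed
  have gowers_sum: "(\<Sum>p\<in>?P. gowers_uniformity d n (bit_sign \<circ> p))
      = (\<Sum>p\<in>?P. \<Sum>(x, y)\<in>cube n \<times> ?Y. bit_sign (h x y p)) / (card (cube n) * card ?Y)"
    by (simp add: gowers_uniformity_eq_sum sum_divide_distrib h_def sign_sum)
  have "(\<Sum>p\<in>?P. \<Sum>(x, y)\<in>cube n \<times> ?Y. bit_sign (h x y p))
      = (\<Sum>(x, y)\<in>cube n \<times> ?Y. \<Sum>p\<in>?P. bit_sign (h x y p))"
    unfolding case_prod_unfold by (rule sum.swap)
  also have "\<dots> \<le> (\<Sum>(x, y)\<in>cube n \<times> ?Y. real (card ?P) * of_bool (y \<in> ?bad))"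
  proof (rule sum_mono)
    fix z assume "z \<in> cube n \<times> ?Y"
    then show "(case z of (x, y) \<Rightarrow> \<Sum>p\<in>?P. bit_sign (h x y p))
        \<le> (case z of (x, y) \<Rightarrow> real (card ?P) * of_bool (y \<in> ?bad))"
      using char_sum[of "snd z" "fst z"] unfolding case_prod_unfold mem_Times_iff by blast
  qed
  also have "\<dots> = (\<Sum>x\<in>cube n. \<Sum>y\<in>?Y. real (card ?P) * of_bool (y \<in> ?bad))"
    by (rule sum.cartesian_product[symmetric])
  also have "\<dots> = real (card (cube n)) * (real (card ?P) * real (card ?bad))"
  proof -
    have "(\<Sum>y\<in>?Y. of_bool (y \<in> ?bad)) = real (card (?Y \<inter> ?bad))"
      using finite_directions[of d n] by (subst sum_of_bool_eq) auto
    also have "?Y \<inter> ?bad = ?bad"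
      by blast
    finally show ?thesis
      by (simp only: sum_constant flip: sum_distrib_left)
  qed
  also have "\<dots> \<le> card (cube n) * (card ?P * (2 ^ d / 2 ^ n * card ?Y))"
    by (intro mult_left_mono card_dependent_directions) auto
  finally have "(\<Sum>p\<in>?P. gowers_uniformity d n (bit_sign \<circ> p))
      \<le> card (cube n) * (card ?P * (2 ^ d / 2 ^ n * card ?Y)) / (card (cube n) * card ?Y)"
    unfolding gowers_sum by (rule divide_right_mono) simp
  also have "\<dots> = 2 ^ d / 2 ^ n * card ?P"
  proof -
    have "card ?Y \<noteq> 0"
      using finite_directions[of d n] directions_nonempty[of d n] by (simp only: card_eq_0_iff) blast
    then show ?thesis
      by (simp add: card_cube)
  qed
  finally show ?thesis .
qed

section \<open>Acceptance probabilities\<close>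

text \<open>Exchanging sum and expectation leaves, for each draw of the test, a count to which
  \<open>card_eval_compare\<close> applies.\<close>

lemma sum_accept_prob:
  assumes "finite P"
  shows "(\<Sum>p\<in>P. accept_prob T n (bit_sign \<circ> p))
    = measure_pmf.expectation (T n) (\<lambda>(Q, D). real (card {p \<in> P. D (map bit_sign (map p Q))}))"
proof -
  have "(\<Sum>p\<in>P. accept_prob T n (bit_sign \<circ> p))
      = (\<Sum>p\<in>P. measure_pmf.expectation (T n) (\<lambda>(Q, D). of_bool (D (map bit_sign (map p Q)))))"
  proof (rule sum.cong)
    fix p
    have "accept_prob T n (bit_sign \<circ> p)
        = measure_pmf.expectation (T n) (indicator {(Q, D). D (map (bit_sign \<circ> p) Q)})"
      by (simp add: accept_prob_def)
    also have "indicator {(Q, D). D (map (bit_sign \<circ> p) Q)}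
        = (\<lambda>(Q, D). of_bool (D (map bit_sign (map p Q))) :: real)"
      by (auto simp: indicator_def fun_eq_iff)
    finally show "accept_prob T n (bit_sign \<circ> p)
        = measure_pmf.expectation (T n) (\<lambda>(Q, D). of_bool (D (map bit_sign (map p Q))))" .
  qed simp
  also have "\<dots> = measure_pmf.expectation (T n)
      (\<lambda>z. \<Sum>p\<in>P. (case z of (Q, D) \<Rightarrow> of_bool (D (map bit_sign (map p Q)))))"
    by (rule Bochner_Integration.integral_sum[symmetric])
       (auto intro!: measure_pmf.integrable_const_bound[where B = 1] split: prod.splits)
  also have "(\<lambda>z. \<Sum>p\<in>P. (case z of (Q, D) \<Rightarrow> of_bool (D (map bit_sign (map p Q)))))
      = (\<lambda>(Q, D). real (card {p \<in> P. D (map bit_sign (map p Q))}))"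
    using assms by (auto simp: fun_eq_iff Int_def simp del: map_map)
  finally show ?thesis .
qed

lemma integrable_card_accepted:
  assumes "finite P"
  shows "integrable (measure_pmf M) (\<lambda>(Q, D). real (card {p \<in> P. D (map bit_sign (map p Q))}))"
proof (rule measure_pmf.integrable_const_bound[where B = "card P"])
  show "AE z in measure_pmf M.
      norm (case z of (Q, D) \<Rightarrow> real (card {p \<in> P. D (map bit_sign (map p Q))})) \<le> card P"
    using assms by (auto intro!: AE_I2 card_mono split: prod.splits)
qed simp

text \<open>The comparison holds for every drawn pair of queries and predicate, because the queries
  cannot depend on the answers; it is then integrated over the draw.\<close>

lemma accept_prob_polynomials_ge:
  assumes d: "d \<ge> 2" and q: "q \<ge> 1" and n: "n \<ge> 1" and T: "nonadaptive_test q T"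
  shows "2 powr (- real q + 1/2 * real q powr (1 / real d))
      * ((\<Sum>p\<in>linear_forms n. accept_prob T n (bit_sign \<circ> p)) / card (linear_forms n))
    \<le> (\<Sum>p\<in>polynomials d n. accept_prob T n (bit_sign \<circ> p)) / card (polynomials d n)"
proof -
  let ?\<delta> = "2 powr (- real q + 1/2 * real q powr (1 / real d))"
  let ?a = "\<lambda>P (Q, D). real (card {p \<in> P. D (map bit_sign (map p Q))})"
  let ?L = "linear_forms n" and ?P = "polynomials d n"
  have fin: "finite ?L" "finite ?P"
    using additive_linear_forms additive_polynomials by (auto simp: additive_family_def)
  have "measure_pmf.expectation (T n) (\<lambda>z. ?\<delta> * (?a ?L z / card ?L))
      \<le> measure_pmf.expectation (T n) (\<lambda>z. ?a ?P z / card ?P)"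
  proof (rule integral_mono_AE)
    show "integrable (measure_pmf (T n)) (\<lambda>z. ?\<delta> * (?a ?L z / card ?L))"
      by (intro integrable_mult_right integrable_divide integrable_card_accepted fin)
    show "integrable (measure_pmf (T n)) (\<lambda>z. ?a ?P z / card ?P)"
      by (intro integrable_divide integrable_card_accepted fin)
    have "?\<delta> * (?a ?L z / card ?L) \<le> ?a ?P z / card ?P" if z: "z \<in> set_pmf (T n)" for z
    proof -
      obtain Q D where zQD: "z = (Q, D)"
        by (cases z)
      have Q: "length Q = q" "set Q \<subseteq> cube n"
        using T n z zQD unfolding nonadaptive_test_def by blast+
      have "?\<delta> * (?a ?L z / card ?L)
          \<le> (card ((\<lambda>p. map p Q) ` ?L) / card ((\<lambda>p. map p Q) ` ?P)) * (?a ?L z / card ?L)"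
        unfolding zQD by (intro mult_right_mono polynomials_linear_forms_ratio[OF d q Q]) auto
      \<comment> \<open>The predicate reads signs, so composing it with \<open>bit_sign\<close>
        gives a predicate on bits.\<close>
      also have "\<dots> \<le> ?a ?P z / card ?P"
        using card_eval_compare[OF additive_polynomials additive_linear_forms
            linear_forms_subset_polynomials, of d n "\<lambda>v. D (map bit_sign v)" Q] d
        by (simp add: zQD mult.commute)
      finally show ?thesis .
    qed
    then show "AE z in measure_pmf (T n). ?\<delta> * (?a ?L z / card ?L) \<le> ?a ?P z / card ?P"
      by (simp only: AE_measure_pmf_iff) blast
  qed
  then show ?thesis
    by (simp only: sum_accept_prob[OF fin(1)] sum_accept_prob[OF fin(2)]
        integral_mult_right_zero integral_divide_zero)
qed

lemma completeness_le_average: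
  assumes "relaxed_linearity_test d c s T" "n \<ge> 1"
  shows "c \<le> (\<Sum>p\<in>linear_forms n. accept_prob T n (bit_sign \<circ> p)) / card (linear_forms n)"
proof -
  have "c \<le> accept_prob T n (bit_sign \<circ> p)" if "p \<in> linear_forms n" for p
    using assms linear_function_linear_form[OF that] boolean_function_sign
    by (auto simp: relaxed_linearity_test_def)
  then have "(\<Sum>p\<in>linear_forms n. c) \<le> (\<Sum>p\<in>linear_forms n. accept_prob T n (bit_sign \<circ> p))"
    by (rule sum_mono)
  moreover have "card (linear_forms n) > 0"
    using additive_linear_forms[of n] by (simp add: additive_family_def card_gt_0_iff)
  ultimately show ?thesis
    by (simp add: field_simps)
qed

text \<open>Markov's inequality in linear form: each acceptance probability is at most
  \<open>t\<close> plus a multiple of the uniformity. Small uniformity uses \<open>sound\<close> and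
  nonnegativity, large uniformity the trivial bound 1.\<close>

lemma average_le_soundness:
  assumes d: "d \<ge> 1" and n: "n \<ge> 1" and \<epsilon>: "\<epsilon> > 0"
    and sound: "\<And>f. boolean_function n f \<Longrightarrow> gowers_uniformity d n f \<le> \<epsilon> \<Longrightarrow> accept_prob T n f \<le> t"
  shows "(\<Sum>p\<in>polynomials d n. accept_prob T n (bit_sign \<circ> p)) / card (polynomials d n)
    \<le> t + (1 + \<bar>t\<bar>) / \<epsilon> * (2 ^ d / 2 ^ n)"
proof -
  let ?P = "polynomials d n" and ?k = "(1 + \<bar>t\<bar>) / \<epsilon>"
  have k: "?k \<ge> 0"
    using \<epsilon> by simp
  have "accept_prob T n (bit_sign \<circ> p) \<le> t + ?k * gowers_uniformity d n (bit_sign \<circ> p)" for p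
  proof (cases "gowers_uniformity d n (bit_sign \<circ> p) \<le> \<epsilon>")
    case True
    have "0 \<le> ?k * gowers_uniformity d n (bit_sign \<circ> p)"
      using k gowers_uniformity_nonneg[OF d] by (intro mult_nonneg_nonneg)
    then show ?thesis
      using sound[OF boolean_function_sign True] by linarith
  next
    case False
    have "accept_prob T n (bit_sign \<circ> p) \<le> 1"
      by (simp add: accept_prob_def)
    \<comment> \<open>The slope gives \<open>t + 1 + \<bar>t\<bar>\<close> here; the absolute value
      covers negative \<open>t\<close>.\<close>
    also have "1 \<le> t + ?k * \<epsilon>"
      using \<epsilon> by simp
    also have "\<dots> \<le> t + ?k * gowers_uniformity d n (bit_sign \<circ> p)"
      using False k by (intro add_left_mono mult_left_mono) auto
    finally show ?thesis .
  qed
  then have "(\<Sum>p\<in>?P. accept_prob T n (bit_sign \<circ> p))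
      \<le> (\<Sum>p\<in>?P. t + ?k * gowers_uniformity d n (bit_sign \<circ> p))"
    by (rule sum_mono)
  also have "\<dots> = card ?P * t + ?k * (\<Sum>p\<in>?P. gowers_uniformity d n (bit_sign \<circ> p))"
    by (simp only: sum.distrib sum_constant flip: sum_distrib_left)
  also have "\<dots> \<le> card ?P * t + ?k * (2 ^ d / 2 ^ n * card ?P)"
    by (intro add_left_mono mult_left_mono sum_gowers_polynomials k)
  also have "\<dots> = (t + ?k * (2 ^ d / 2 ^ n)) * card ?P"
    by (simp only: algebra_simps)
  finally show ?thesis
    using additive_polynomials[of d n]
    by (simp add: additive_family_def card_gt_0_iff pos_divide_le_eq)
qed

section \<open>Passing to the limit and deriving the bounds\<close>

text \<open>The order of limits matters: the slope \<open>?k\<close> depends on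
  \<open>\<epsilon>\<close>, so first \<open>n\<close> tends to infinity with
  \<open>\<epsilon>\<close> fixed, and only then \<open>\<epsilon>\<close> tends to 0.\<close>

lemma soundness_ge:
  assumes d: "d \<ge> 2" and q: "q \<ge> 1" and T: "nonadaptive_test q T" "relaxed_linearity_test d c s T"
  shows "2 powr (- real q + 1/2 * real q powr (1 / real d)) * c \<le> s"
proof -
  let ?\<delta> = "2 powr (- real q + 1/2 * real q powr (1 / real d))"
  obtain \<epsilon>' where \<epsilon>': "(\<epsilon>' \<longlongrightarrow> 0) (at_right (0::real))"
    and sound: "\<And>\<epsilon> n f. \<epsilon> > 0 \<Longrightarrow> n \<ge> 1 \<Longrightarrow> boolean_function n f \<Longrightarrow> gowers_uniformity d n f \<le> \<epsilon>
      \<Longrightarrow> accept_prob T n f \<le> s + \<epsilon>' \<epsilon>"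
    using T(2) unfolding relaxed_linearity_test_def by blast
  have "?\<delta> * c \<le> s + \<epsilon>' \<epsilon>" if \<epsilon>: "\<epsilon> > 0" for \<epsilon>
  proof (rule tendsto_lowerbound)
    let ?k = "(1 + \<bar>s + \<epsilon>' \<epsilon>\<bar>) / \<epsilon>"
    have "(\<lambda>n. 2 ^ d / 2 ^ n :: real) \<longlonglongrightarrow> 0"
      by real_asymp
    from tendsto_add[OF tendsto_const tendsto_mult[OF tendsto_const this]]
    show "(\<lambda>n. (s + \<epsilon>' \<epsilon>) + ?k * (2 ^ d / 2 ^ n)) \<longlonglongrightarrow> s + \<epsilon>' \<epsilon>"
      by (metis add.right_neutral mult_zero_right)
    have "?\<delta> * c \<le> (s + \<epsilon>' \<epsilon>) + ?k * (2 ^ d / 2 ^ n)" if n: "n \<ge> 1" for n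
    proof -
      have "?\<delta> * c \<le> ?\<delta> * ((\<Sum>p\<in>linear_forms n. accept_prob T n (bit_sign \<circ> p)) / card (linear_forms n))"
        by (intro mult_left_mono completeness_le_average[OF T(2) n]) simp
      also have "\<dots> \<le> (\<Sum>p\<in>polynomials d n. accept_prob T n (bit_sign \<circ> p)) / card (polynomials d n)"
        by (rule accept_prob_polynomials_ge[OF d q n T(1)])
      also have "\<dots> \<le> (s + \<epsilon>' \<epsilon>) + ?k * (2 ^ d / 2 ^ n)"
        using d by (intro average_le_soundness n \<epsilon> sound) auto
      finally show ?thesis .
    qed
    then show "\<forall>\<^sub>F n in sequentially. ?\<delta> * c \<le> (s + \<epsilon>' \<epsilon>) + ?k * (2 ^ d / 2 ^ n)"
      by (intro eventually_sequentiallyI)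
  qed simp
  then have "\<forall>\<^sub>F \<epsilon> in at_right 0. ?\<delta> * c \<le> s + \<epsilon>' \<epsilon>"
    by (intro eventually_at_rightI[of 0 1]) auto
  moreover have "((\<lambda>\<epsilon>. s + \<epsilon>' \<epsilon>) \<longlongrightarrow> s) (at_right 0)"
    using tendsto_add[OF tendsto_const \<epsilon>', of s] by simp
  ultimately show ?thesis
    by (intro tendsto_lowerbound) (auto simp: trivial_limit_at_right_real)
qed

text \<open>The zero form is linear, so \<open>c\<close> is bounded by an actual
  probability.\<close>

lemma completeness_le_1:
  assumes "relaxed_linearity_test d c s T"
  shows "c \<le> 1"
proof -
  have "linear_function 1 (bit_sign \<circ> (\<lambda>x. \<Sum>i\<in>{}. x i))"
    unfolding linear_forms_def by (intro linear_function_linear_form[unfolded linear_forms_def] imageI) simp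
  then have "c \<le> accept_prob T 1 (bit_sign \<circ> (\<lambda>x. \<Sum>i\<in>{}. x i))"
    using assms boolean_function_sign unfolding relaxed_linearity_test_def by blast
  also have "\<dots> \<le> 1"
    by (simp add: accept_prob_def)
  finally show ?thesis .
qed

text \<open>With \<open>u\<close> the \<open>d\<close>-th root of \<open>q\<close>, the hypothesis
  bounds \<open>log 2 (1 / s)\<close> by \<open>q - u / 2\<close>, and
  \<open>q / (q - u / 2)\<close> is at least \<open>1 + u / (2 * q)\<close>.\<close>

lemma amortized_query_complexity_ge:
  assumes d: "d \<ge> 2" and q: "q \<ge> 1"
    and s: "2 powr (- real q + 1/2 * real q powr (1 / real d)) \<le> s"
  shows "ereal (1 + 1/2 * (1 / real q powr ((real d - 1) / real d))) \<le> amortized_query_complexity q s"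
proof (cases "s \<ge> 1")
  case True
  then show ?thesis
    by (simp add: amortized_query_complexity_def)
next
  case False
  define u where "u = real q powr (1 / real d)"
  have s0: "s > 0"
    using s by (rule less_le_trans[rotated]) simp
  have "- real q + 1/2 * u \<le> log 2 s"
    using s s0 by (simp add: le_log_iff u_def)
  then have L: "log 2 (1 / s) \<le> real q - 1/2 * u"
    using s0 by (simp add: log_divide)
  have L0: "0 < log 2 (1 / s)"
    using False s0 by simp
  have u0: "u > 0"
    using q by (simp add: u_def)
  have "1 / real q powr ((real d - 1) / real d) = u / real q"
  proof -
    have "real q powr ((real d - 1) / real d) * u = real q powr 1"
      using d by (simp add: u_def diff_divide_distrib flip: powr_add)
    then show ?thesis
      using q u0 by (simp add: field_simps)
  qed
  then have "1 + 1/2 * (1 / real q powr ((real d - 1) / real d)) = (real q + 1/2 * u) / real q"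
    using q by (simp add: field_simps)
  also have "\<dots> \<le> real q / (real q - 1/2 * u)"
  proof -
    \<comment> \<open>Difference of squares; the denominator \<open>q - u / 2\<close> is positive
      because \<open>s < 1\<close>.\<close>
    have "(real q + 1/2 * u) * (real q - 1/2 * u) \<le> real q * real q"
      by (simp add: algebra_simps)
    moreover have "0 < real q - 1/2 * u"
      using L L0 by linarith
    ultimately show ?thesis
      using q by (simp add: divide_le_eq pos_le_divide_eq)
  qed
  also have "\<dots> \<le> real q / log 2 (1 / s)"
    using L L0 by (intro divide_left_mono mult_pos_pos) linarith+
  finally show ?thesis
    using False s0 by (simp add: amortized_query_complexity_def)
qed

theorem theorem24:
  fixes d :: nat
  assumes "d \<ge> 2"
  shows "\<exists>C > (0::real). \<exists>C' > (0::real).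
    \<forall>(q::nat) (c::real) (s::real) (T::test).
      q \<ge> 1 \<longrightarrow> nonadaptive_test q T \<longrightarrow> relaxed_linearity_test d c s T \<longrightarrow>
        1 - c + s \<ge> 2 powr (- real q + C * real q powr (1 / real d)) \<and>
        (c = 1 \<longrightarrow>
          amortized_query_complexity q s
            \<ge> ereal (1 + C' * (1 / real q powr ((real d - 1) / real d))))"
proof (intro exI[of _ "1/2"] conjI allI impI)
  fix q :: nat and c s :: real and T :: test
  assume q: "q \<ge> 1" and T: "nonadaptive_test q T" "relaxed_linearity_test d c s T"
  let ?\<delta> = "2 powr (- real q + 1/2 * real q powr (1 / real d))"
  have s: "?\<delta> * c \<le> s"
    by (rule soundness_ge[OF assms q T])
  \<comment> \<open>The root is at most \<open>q\<close>, so the exponent in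
    \<open>?\<delta>\<close> is nonpositive and \<open>?\<delta> \<le> 1\<close>.\<close>
  have "real q powr (1 / real d) \<le> real q powr 1"
    using q assms by (intro powr_mono) auto
  then have "?\<delta> \<le> 2 powr 0"
    by (intro powr_mono) auto
  \<comment> \<open>Expanding this product turns the multiplicative bound
    \<open>?\<delta> * c \<le> s\<close> into the additive one.\<close>
  then have "0 \<le> (1 - ?\<delta>) * (1 - c)"
    using completeness_le_1[OF T(2)] by (intro mult_nonneg_nonneg) auto
  then have "?\<delta> \<le> 1 - c + ?\<delta> * c"
    by (simp only: algebra_simps)
  then show "?\<delta> \<le> 1 - c + s"
    using s by linarith
  show "ereal (1 + 1/2 * (1 / real q powr ((real d - 1) / real d))) \<le> amortized_query_complexity q s"
    if "c = 1"
    using s that by (intro amortized_query_complexity_ge[OF assms q]) simp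
qed auto

end
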